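(* For every integer $r\geqslant1$, $$\delta\Big(\sum_{\mathbf{a}\in\mathcal{A}_{2r}}(-1)^{\mathrm{depth}(\mathbf{a})}\,4^{\mathrm{height}(\mathbf{a})-1}\,[\mathbf{a}]\Big)=(-1)^r3^{2r-1}(\underbrace{2,\ldots,2}_r).$$
   Context: A composition is a finite sequence $\mathbf{a}=(a_1,\ldots,a_r)$ of positive integers ($r\geqslant0$), of depth $r$ and weight $\sum a_i$; its height is the number of its entries that are $\geqslant2$. It is admissible if $r=0$ or $a_1\geqslant2$. $\mathcal{A}$ (resp. $\mathcal{A}_k$) is the set of admissible compositions (resp. of weight $k$). Binary word $\mathbf{w}(\mathbf{a})=0^{a_1-1}1\cdots0^{a_r-1}1$; the dual of a word $\varepsilon_1\cdots\varepsilon_k$ is $\overline{\varepsilon_k}\cdots\overline{\varepsilon_1}$ ($\overline0=1,\overline1=0$); $\overline{\mathbf{a}}$ is the admissible composition with word dual to $\mathbf{w}(\mathbf{a})$. $\mathcal{B}=\mathcal{A}/(\mathbf{a}\sim\overline{\mathbf{a}})$, classes $[\mathbf{a}]$, $\mathcal{B}_k$ classes of weight $k$; $\mathbf{Z}^{(X)}$ is the free $\mathbf{Z}$-module on $X$. $(a_1,\ldots,a_r)^{\rm init}=(a_1,\ldots,a_{r-1})$ ($\varnothing^{\rm init}=\varnothing$); for admissible $\mathbf{a}$, $\mathbf{a}^{\rm fin}$ is the dual of $(\overline{\mathbf{a}})^{\rm init}$ and $\mathbf{a}^{\rm mid}=(\mathbf{a}^{\rm fin})^{\rm init}$; extended $\mathbf{Z}$-linearly.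 $\delta$ is the unique $\mathbf{Z}$-linear map $\mathbf{Z}^{(\mathcal{B})}\to\mathbf{Z}^{(\mathcal{A})}$ with $\delta(\mathbf{Z}^{\mathcal{B}_k})\subset\mathbf{Z}^{\mathcal{A}_k}$ for all $k$, $\delta([\varnothing])=\varnothing$, and $\delta([\mathbf{a}])^{\rm init}=\delta([\mathbf{a}^{\rm init}])+\delta([\mathbf{a}^{\rm mid}])+\delta([\mathbf{a}^{\rm fin}])$ for all non-empty admissible $\mathbf{a}$. *)

theory Defs
  imports Complex_Main "HOL-Library.Poly_Mapping"
begin

text \<open>
  The free \<open>\<int>\<close>-module on a type \<open>'x\<close> is \<open>'x \<Rightarrow>\<^sub>0 int\<close>, with basis vectors \<^const>\<open>frag_of\<close>,
  scalar multiplication \<^const>\<open>frag_cmul\<close> and linear extension \<^const>\<open>frag_extend\<close>.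
\<close>

definition composition :: "nat list \<Rightarrow> bool" where
  "composition a \<longleftrightarrow> (\<forall>x\<in>set a. 1 \<le> x)"

definition admissible :: "nat list \<Rightarrow> bool" where
  "admissible a \<longleftrightarrow> composition a \<and> (a = [] \<or> 2 \<le> hd a)"

typedef adm = "{a. admissible a}"
  morphisms list_of Adm
  by (rule exI[of _ "[]"]) (simp add: admissible_def composition_def)

definition empty_adm :: adm ("\<emptyset>") where
  "\<emptyset> = Adm []"

definition depth :: "adm \<Rightarrow> nat" where
  "depth a = length (list_of a)"

definition weight :: "adm \<Rightarrow> nat" where
  "weight a = sum_list (list_of a)"

definition height :: "adm \<Rightarrow> nat" where
  "height a = length (filter (\<lambda>x. 2 \<le> x) (list_of a))"

definition adm_of_weight :: "nat \<Rightarrow> adm set" where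
  "adm_of_weight k = {a. weight a = k}"

text \<open>Binary words are lists of booleans, with \<open>False\<close> for the letter 0 and \<open>True\<close> for 1.\<close>

definition word :: "nat list \<Rightarrow> bool list" where
  "word a = concat (map (\<lambda>x. replicate (x - 1) False @ [True]) a)"

definition dual_word :: "bool list \<Rightarrow> bool list" where
  "dual_word w = rev (map Not w)"

definition dual :: "adm \<Rightarrow> adm" where
  "dual a = (THE b. word (list_of b) = dual_word (word (list_of a)))"

definition init :: "adm \<Rightarrow> adm" where
  "init a = Adm (butlast (list_of a))"

definition fin :: "adm \<Rightarrow> adm" where
  "fin a = dual (init (dual a))"

definition mid :: "adm \<Rightarrow> adm" where
  "mid a = init (fin a)"

definition init_lin :: "(adm \<Rightarrow>\<^sub>0 int) \<Rightarrow> (adm \<Rightarrow>\<^sub>0 int)" where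
  "init_lin = frag_extend (\<lambda>a. frag_of (init a))"

definition dual_equiv :: "adm \<Rightarrow> adm \<Rightarrow> bool" where
  "dual_equiv a b \<longleftrightarrow> b = a \<or> b = dual a"

lemma admissible_list_of: "admissible (list_of a)"
  using list_of by simp

lemma list_of_Adm: "admissible a \<Longrightarrow> list_of (Adm a) = a"
  by (simp add: Adm_inverse)

lemma word_Nil [simp]: "word [] = []"
  by (simp add: word_def)

lemma word_Cons: "word (x # a) = replicate (x - 1) False @ True # word a"
  by (simp add: word_def)

lemma word_append: "word (a @ b) = word a @ word b"
  by (simp add: word_def)

lemma word_eq_Nil_iff [simp]: "word a = [] \<longleftrightarrow> a = []"
  by (cases a) (simp_all add: word_Cons)

lemma word_inj: "composition a \<Longrightarrow> composition b \<Longrightarrow> word a = word b \<Longrightarrow> a = b"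
proof (induction a arbitrary: b)
  case Nil
  then show ?case by (metis word_eq_Nil_iff)
next
  case (Cons x a)
  then obtain y c where b: "b = y # c"
    by (metis list.exhaust word_eq_Nil_iff)
  have eq: "replicate (x - 1) False @ True # word a = replicate (y - 1) False @ True # word c"
    using Cons.prems b by (simp add: word_Cons)
  have tw: "takeWhile Not (replicate n False @ True # w) = replicate n False" for n w
    by (induction n) auto
  have "replicate (x - 1) False = replicate (y - 1) False"
    using eq tw by metis
  then have xy: "x - 1 = y - 1"
    by (metis length_replicate)
  then have "word a = word c"
    using eq by simp
  moreover have "x = y"
    using xy Cons.prems b by (auto simp: composition_def)
  ultimately show ?case
    using Cons b by (simp add: composition_def)
qed

lemma word_ex: "w = [] \<or> last w \<Longrightarrow> \<exists>a. composition a \<and> word a = w"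
proof (induction w)
  case Nil
  show ?case by (rule exI[of _ "[]"]) (simp add: composition_def)
next
  case (Cons e w)
  have "w = [] \<or> last w"
    using Cons.prems by (simp split: if_splits)
  then obtain a where a: "composition a" "word a = w"
    using Cons.IH by blast
  show ?case
  proof (cases e)
    case True
    then show ?thesis
      using a by (intro exI[of _ "1 # a"]) (simp add: word_Cons composition_def)
  next
    case False
    then have "w \<noteq> []"
      using Cons.prems by auto
    then obtain x b where b: "a = x # b"
      using a by (cases a) auto
    then have "1 \<le> x"
      using a by (simp add: composition_def)
    then obtain m where "x = Suc m"
      by (cases x) auto
    then have "word (Suc x # b) = e # w"
      using a b False by (auto simp: word_Cons)
    moreover have "composition (Suc x # b)"
      using a b by (simp add: composition_def)
    ultimately show ?thesis
      by blast
  qed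
qed

lemma last_word: "a \<noteq> [] \<Longrightarrow> last (word a)"
  by (cases a rule: rev_cases) (simp_all add: word_append word_Cons)

lemma hd_word: "composition a \<Longrightarrow> a \<noteq> [] \<Longrightarrow> \<not> hd (word a) \<longleftrightarrow> 2 \<le> hd a"
proof (cases a)
  case (Cons x b)
  then show ?thesis by (cases "x - 1") (auto simp: word_Cons)
qed simp

lemma length_word: "composition a \<Longrightarrow> length (word a) = sum_list a"
  by (induction a) (auto simp: word_Cons composition_def)

lemma dual_word_dual_word [simp]: "dual_word (dual_word w) = w"
  by (simp add: dual_word_def rev_map comp_def)

lemma dual_word_Nil_iff [simp]: "dual_word w = [] \<longleftrightarrow> w = []"
  by (simp add: dual_word_def)

lemma adm_eqI: "word (list_of a) = word (list_of b) \<Longrightarrow> a = b"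
  using word_inj[of "list_of a" "list_of b"] admissible_list_of[of a] admissible_list_of[of b]
  by (simp add: admissible_def list_of_inject)

lemma word_dual: "word (list_of (dual a)) = dual_word (word (list_of a))"
proof -
  let ?w = "dual_word (word (list_of a))"
  have adm: "admissible (list_of a)" by (rule admissible_list_of)
  have ends: "last ?w \<and> \<not> hd ?w" if "?w \<noteq> []"
  proof -
    have ne: "list_of a \<noteq> []" "word (list_of a) \<noteq> []"
      using that by auto
    then show ?thesis
      using adm hd_word[of "list_of a"] last_word[of "list_of a"]
      by (simp add: admissible_def dual_word_def hd_rev last_rev last_map hd_map)
  qed
  then obtain b where b: "composition b" "word b = ?w"
    using word_ex by blast
  have "admissible b"
  proof (cases "b = []")
    case False
    then have "?w \<noteq> []" using b(2) by (metis word_eq_Nil_iff)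
    then have "\<not> hd (word b)" using ends b(2) by simp
    then show ?thesis using False b(1) hd_word[of b] by (simp add: admissible_def)
  qed (simp add: admissible_def composition_def)
  then have "word (list_of (Adm b)) = ?w"
    using b by (simp add: list_of_Adm)
  then have "\<exists>!b. word (list_of b) = ?w"
    by (intro ex1I[of _ "Adm b"]) (auto intro: adm_eqI)
  then show ?thesis
    unfolding dual_def by (rule theI')
qed

lemma dual_dual [simp]: "dual (dual a) = a"
  by (rule adm_eqI) (simp add: word_dual)

lemma weight_dual [simp]: "weight (dual a) = weight a"
proof -
  have "weight b = length (word (list_of b))" for b
    using admissible_list_of[of b] by (simp add: weight_def length_word admissible_def)
  then show ?thesis
    by (simp add: word_dual dual_word_def)
qed

lemma finite_adm_of_weight: "finite (adm_of_weight k)"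
proof (rule inj_on_finite)
  show "inj_on (\<lambda>a. word (list_of a)) (adm_of_weight k)"
    by (rule inj_onI) (rule adm_eqI)
  show "(\<lambda>a. word (list_of a)) ` adm_of_weight k \<subseteq> {w. set w \<subseteq> UNIV \<and> length w = k}"
  proof (rule image_subsetI)
    fix a assume "a \<in> adm_of_weight k"
    moreover have "composition (list_of a)"
      using admissible_list_of[of a] by (simp add: admissible_def)
    ultimately show "word (list_of a) \<in> {w. set w \<subseteq> UNIV \<and> length w = k}"
      by (simp add: adm_of_weight_def weight_def length_word)
  qed
  show "finite {w :: bool list. set w \<subseteq> UNIV \<and> length w = k}"
    by (rule finite_lists_length_eq) simp
qed

quotient_type adm_class = adm / dual_equiv
  morphisms rep_class cls
proof (rule equivpI)
  show "reflp dual_equiv"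
    by (simp add: reflp_def dual_equiv_def)
  show "symp dual_equiv"
    by (auto simp: symp_def dual_equiv_def)
  show "transp dual_equiv"
    by (auto simp: transp_def dual_equiv_def)
qed

definition class_of_weight :: "nat \<Rightarrow> adm_class set" where
  "class_of_weight k = cls ` adm_of_weight k"

definition is_delta :: "((adm_class \<Rightarrow>\<^sub>0 int) \<Rightarrow> (adm \<Rightarrow>\<^sub>0 int)) \<Rightarrow> bool" where
  "is_delta d \<longleftrightarrow>
     module_hom frag_cmul frag_cmul d \<and>
     (\<forall>k x. Poly_Mapping.keys x \<subseteq> class_of_weight k \<longrightarrow> Poly_Mapping.keys (d x) \<subseteq> adm_of_weight k) \<and>
     d (frag_of (cls \<emptyset>)) = frag_of \<emptyset> \<and>
     (\<forall>a. a \<noteq> \<emptyset> \<longrightarrow>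
        init_lin (d (frag_of (cls a))) =
          d (frag_of (cls (init a))) + d (frag_of (cls (mid a))) + d (frag_of (cls (fin a))))"

lemma cls_dual [simp]: "cls (dual a) = cls a"
  by (metis adm_class.abs_eq_iff dual_equiv_def dual_dual)

lemma list_of_empty [simp]: "list_of \<emptyset> = []"
  by (simp add: empty_adm_def list_of_Adm admissible_def composition_def)

lemma list_of_eq_Nil [simp]: "list_of a = [] \<longleftrightarrow> a = \<emptyset>"
  by (metis list_of_empty list_of_inject)

lemma admissible_butlast: "admissible a \<Longrightarrow> admissible (butlast a)"
  by (cases a) (auto simp: admissible_def composition_def dest: in_set_butlastD)

lemma list_of_init: "list_of (init a) = butlast (list_of a)"
  by (simp add: init_def list_of_Adm admissible_butlast admissible_list_of)

lemma weight_ge_2: "a \<noteq> \<emptyset> \<Longrightarrow> 2 \<le> weight a"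
  using admissible_list_of[of a]
  by (cases "list_of a") (auto simp: admissible_def weight_def)

lemma weight_empty [simp]: "weight \<emptyset> = 0"
  by (simp add: weight_def)

lemma weight_eq_0 [simp]: "weight a = 0 \<longleftrightarrow> a = \<emptyset>"
  using weight_ge_2[of a] by (cases "a = \<emptyset>") auto

lemma init_empty [simp]: "init \<emptyset> = \<emptyset>"
  by (simp add: init_def empty_adm_def[symmetric])

lemma dual_empty_iff [simp]: "dual a = \<emptyset> \<longleftrightarrow> a = \<emptyset>"
  using weight_dual[of a] weight_eq_0 by metis

lemma dual_empty [simp]: "dual \<emptyset> = \<emptyset>"
  by simp

lemma weight_init_last:
  assumes "a \<noteq> \<emptyset>"
  shows "weight a = weight (init a) + last (list_of a)" "1 \<le> last (list_of a)"
proof -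
  have ne: "list_of a \<noteq> []" using assms by simp
  have "sum_list (list_of a) = sum_list (butlast (list_of a) @ [last (list_of a)])"
    using ne by simp
  then show "weight a = weight (init a) + last (list_of a)"
    by (simp add: weight_def list_of_init)
  show "1 \<le> last (list_of a)"
    using ne admissible_list_of[of a] last_in_set[OF ne] by (auto simp: admissible_def composition_def)
qed

lemma weight_init_less: "a \<noteq> \<emptyset> \<Longrightarrow> weight (init a) < weight a"
  using weight_init_last[of a] by linarith

lemma weight_init_le: "weight (init a) \<le> weight a"
  using weight_init_less[of a] by (cases "a = \<emptyset>") auto

lemma weight_fin_less: "a \<noteq> \<emptyset> \<Longrightarrow> weight (fin a) < weight a"
  unfolding fin_def using weight_init_less[of "dual a"] by simp

lemma weight_mid_less: "a \<noteq> \<emptyset> \<Longrightarrow> weight (mid a) < weight a"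
  unfolding mid_def using weight_fin_less[of a] weight_init_le[of "fin a"] by linarith

definition fin_list :: "nat list \<Rightarrow> nat list" where
  "fin_list a = (case a of [] \<Rightarrow> [] | x # b \<Rightarrow> if 3 \<le> x then (x - 1) # b else dropWhile (\<lambda>y. y = 1) b)"

lemma dropWhile_word: "composition a \<Longrightarrow> dropWhile id (word a) = word (dropWhile (\<lambda>y. y = 1) a)"
proof (induction a)
  case (Cons x a)
  show ?case
  proof (cases "x = 1")
    case True
    then show ?thesis using Cons by (simp add: word_Cons composition_def)
  next
    case False
    then obtain m where "x - 1 = Suc m"
      using Cons.prems by (cases "x - 1") (auto simp: composition_def)
    then show ?thesis using False by (simp add: word_Cons)
  qed
qed simp

lemma word_fin_list:
  assumes "admissible a" shows "word (fin_list a) = dropWhile id (tl (word a))"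
proof (cases a)
  case (Cons x b)
  show ?thesis
  proof (cases "3 \<le> x")
    case True
    then obtain m where "x = Suc (Suc (Suc m))"
      by (metis Suc_le_D numeral_3_eq_3 Suc_le_mono)
    then show ?thesis using Cons by (simp add: fin_list_def word_Cons)
  next
    case False
    then have "x = 2" using assms Cons by (auto simp: admissible_def)
    then show ?thesis
      using assms Cons dropWhile_word[of b]
      by (simp add: fin_list_def word_Cons admissible_def composition_def)
  qed
qed (simp add: fin_list_def)

lemma hd_word_adm: "a \<noteq> \<emptyset> \<Longrightarrow> \<not> hd (word (list_of a))"
  using hd_word[of "list_of a"] admissible_list_of[of a] by (auto simp: admissible_def)

lemma word_fin: "word (list_of (fin a)) = dropWhile id (tl (word (list_of a)))"
proof (cases "a = \<emptyset>")
  case False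
  let ?b = "list_of (dual a)" and ?v = "word (list_of (fin a))"
  have ne: "?b \<noteq> []" using False by simp
  have "word ?b = word (butlast ?b @ [last ?b])"
    using ne by simp
  then have "word ?b = word (butlast ?b) @ replicate (last ?b - 1) False @ [True]"
    by (simp only: word_append word_Cons word_Nil)
  then have "dual_word (word ?b) = False # replicate (last ?b - 1) True @ dual_word (word (butlast ?b))"
    by (simp add: dual_word_def)
  then have *: "word (list_of a) = False # replicate (last ?b - 1) True @ ?v"
    by (simp add: fin_def word_dual list_of_init)
  have "dropWhile id ?v = ?v"
  proof (cases "fin a = \<emptyset>")
    case False
    then have "\<not> hd ?v" by (rule hd_word_adm)
    then show ?thesis by (cases ?v) auto
  qed simp
  then have "dropWhile id (replicate n True @ ?v) = ?v" for n
    by (induction n) auto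
  then show ?thesis by (simp add: *)
qed (simp add: fin_def)

lemma admissible_dropWhile:
  assumes "composition b" shows "admissible (dropWhile (\<lambda>y. y = 1) b)"
proof -
  let ?c = "dropWhile (\<lambda>y. y = 1) b"
  have "composition ?c"
    using assms by (auto simp: composition_def dest: set_dropWhileD)
  moreover have "2 \<le> hd ?c" if "?c \<noteq> []"
  proof -
    have "1 \<le> hd ?c"
      using \<open>composition ?c\<close> hd_in_set[OF that] unfolding composition_def by blast
    then show ?thesis
      using hd_dropWhile[OF that] by linarith
  qed
  ultimately show ?thesis by (auto simp: admissible_def)
qed

lemma admissible_fin_list: "admissible a \<Longrightarrow> admissible (fin_list a)"
proof (cases a)
  case (Cons x b)
  assume "admissible a"
  then show ?thesis
    using Cons admissible_dropWhile[of b]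
    by (auto simp: fin_list_def admissible_def composition_def)
qed (simp add: fin_list_def)

lemma list_of_fin: "list_of (fin a) = fin_list (list_of a)"
  using admissible_list_of[of a] admissible_list_of[of "fin a"] admissible_fin_list[of "list_of a"]
  by (intro word_inj) (simp_all add: word_fin word_fin_list admissible_def)

lemma butlast_dropWhile: "butlast (dropWhile P xs) = dropWhile P (butlast xs)"
  by (induction xs) auto

lemma init_fin: "init (fin a) = fin (init a)"
proof -
  have "butlast (fin_list l) = fin_list (butlast l)" for l
    by (cases l) (auto simp: fin_list_def butlast_dropWhile)
  then show ?thesis
    by (metis list_of_fin list_of_init list_of_inject)
qed

lemma init_dual: "init (dual a) = dual (fin a)"
  by (simp add: fin_def)

lemma fin_dual: "fin (dual a) = dual (init a)"
  by (simp add: fin_def)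

lemma mid_dual: "mid (dual a) = dual (mid a)"
  by (simp add: mid_def fin_dual init_dual init_fin)

definition snoc :: "nat \<Rightarrow> adm \<Rightarrow> adm" where
  "snoc k c = Adm (list_of c @ [k - weight c])"

lemma list_of_snoc:
  assumes "weight c < k" "2 \<le> k" shows "list_of (snoc k c) = list_of c @ [k - weight c]"
proof -
  have "admissible (list_of c @ [k - weight c])"
  proof (cases "c = \<emptyset>")
    case True
    then show ?thesis using assms by (simp add: admissible_def composition_def)
  next
    case False
    then show ?thesis using assms admissible_list_of[of c]
      by (auto simp: admissible_def composition_def)
  qed
  then show ?thesis by (simp add: snoc_def list_of_Adm)
qed

lemma init_snoc: "weight c < k \<Longrightarrow> 2 \<le> k \<Longrightarrow> init (snoc k c) = c"
  using list_of_init[of "snoc k c"] by (simp add: list_of_snoc list_of_inject)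

lemma weight_snoc: "weight c < k \<Longrightarrow> 2 \<le> k \<Longrightarrow> weight (snoc k c) = k"
  by (simp add: weight_def[of "snoc k c"] list_of_snoc) (simp add: weight_def)

lemma snoc_init: "a \<noteq> \<emptyset> \<Longrightarrow> snoc (weight a) (init a) = a"
  using weight_init_last(1)[of a] by (simp add: snoc_def list_of_init list_of_inverse)

function delta_rec :: "adm \<Rightarrow> (adm \<Rightarrow>\<^sub>0 int)" where
  "delta_rec a = (if a = \<emptyset> then frag_of \<emptyset> else
     frag_extend (\<lambda>c. frag_of (snoc (weight a) c))
       (delta_rec (init a) + delta_rec (mid a) + delta_rec (fin a)))"
  by pat_completeness auto
termination
  by (relation "measure weight") (simp_all add: weight_init_less weight_mid_less weight_fin_less)

declare delta_rec.simps [simp del]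

lemma delta_rec_dual: "delta_rec (dual a) = delta_rec a"
proof (induction "weight a" arbitrary: a rule: less_induct)
  case less
  show ?case
  proof (cases "a = \<emptyset>")
    case False
    then have "delta_rec (dual (init a)) = delta_rec (init a)"
      "delta_rec (dual (mid a)) = delta_rec (mid a)"
      "delta_rec (dual (fin a)) = delta_rec (fin a)"
      using less weight_init_less weight_mid_less weight_fin_less by blast+
    then show ?thesis
      using False by (simp add: delta_rec.simps[of a] delta_rec.simps[of "dual a"]
          init_dual mid_dual fin_dual add_ac)
  qed simp
qed

lemma keys_delta_rec: "Poly_Mapping.keys (delta_rec a) \<subseteq> adm_of_weight (weight a)"
proof (induction "weight a" arbitrary: a rule: less_induct)
  case less
  show ?case
  proof (cases "a = \<emptyset>")
    case True
    then show ?thesis by (simp add: delta_rec.simps adm_of_weight_def)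
  next
    case False
    let ?s = "delta_rec (init a) + delta_rec (mid a) + delta_rec (fin a)"
    have "Poly_Mapping.keys ?s \<subseteq> {c. weight c < weight a}"
    proof -
      have "Poly_Mapping.keys (delta_rec b) \<subseteq> {c. weight c < weight a}" if "weight b < weight a" for b
        using less[OF that] that by (auto simp: adm_of_weight_def)
      then have "Poly_Mapping.keys (delta_rec (init a)) \<subseteq> {c. weight c < weight a}"
        "Poly_Mapping.keys (delta_rec (mid a)) \<subseteq> {c. weight c < weight a}"
        "Poly_Mapping.keys (delta_rec (fin a)) \<subseteq> {c. weight c < weight a}"
        using False weight_init_less weight_mid_less weight_fin_less by blast+
      then show ?thesis
        using Poly_Mapping.keys_add[of "delta_rec (init a) + delta_rec (mid a)" "delta_rec (fin a)"]
          Poly_Mapping.keys_add[of "delta_rec (init a)" "delta_rec (mid a)"] by blast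
    qed
    then have "weight (snoc (weight a) c) = weight a" if "c \<in> Poly_Mapping.keys ?s" for c
      using that weight_snoc weight_ge_2[OF False] by blast
    then show ?thesis
      using False keys_frag_extend[of "\<lambda>c. frag_of (snoc (weight a) c)" ?s]
      by (fastforce simp: delta_rec.simps[of a] adm_of_weight_def)
  qed
qed

lemma module_frag_cmul: "module (frag_cmul :: int \<Rightarrow> ('a \<Rightarrow>\<^sub>0 int) \<Rightarrow> _)"
  by unfold_locales (simp_all add: frag_cmul_distrib frag_cmul_distrib2)

lemma module_hom_frag_extend: "module_hom frag_cmul frag_cmul (frag_extend f)"
  by (simp add: module_hom_def module_hom_axioms_def module_frag_cmul frag_extend_add frag_extend_cmul)

lemma module_hom_eq_frag_extend:
  assumes "module_hom frag_cmul frag_cmul f" shows "f x = frag_extend (\<lambda>b. f (frag_of b)) x"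
proof -
  interpret module_hom frag_cmul frag_cmul f by fact
  have "f x = f (\<Sum>i\<in>Poly_Mapping.keys x. frag_cmul (Poly_Mapping.lookup x i) (frag_of i))"
    by (simp only: frag_expansion[of x, symmetric] frag_extend_def[symmetric])
  then show ?thesis
    by (simp add: sum scale frag_extend_def)
qed

lemma frag_extend_snoc_init_lin:
  assumes "Poly_Mapping.keys x \<subseteq> adm_of_weight k" "k \<noteq> 0"
  shows "frag_extend (\<lambda>c. frag_of (snoc k c)) (init_lin x) = x"
proof -
  have "frag_extend (\<lambda>c. frag_of (snoc k c)) (init_lin x) =
      frag_extend (\<lambda>a. frag_of (snoc k (init a))) x"
    unfolding init_lin_def frag_extend_def[of "\<lambda>a. frag_of (init a)" x]
    by (simp add: frag_extend_sum frag_extend_cmul comp_def) (simp add: frag_extend_def)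
  also have "\<dots> = frag_extend frag_of x"
  proof (rule frag_extend_eq)
    fix a assume "a \<in> Poly_Mapping.keys x"
    then have "weight a = k" using assms by (auto simp: adm_of_weight_def)
    moreover from this have "a \<noteq> \<emptyset>" using assms by auto
    ultimately have "snoc k (init a) = a" using snoc_init[of a] by simp
    then show "frag_of (snoc k (init a)) = frag_of a" by simp
  qed
  finally show ?thesis
    using frag_expansion[of x, symmetric] by simp
qed

lemma is_delta_unique:
  assumes "is_delta d" "is_delta e" shows "d = e"
proof -
  have keys: "Poly_Mapping.keys (f (frag_of (cls a))) \<subseteq> adm_of_weight (weight a)" if "is_delta f" for f a
  proof -
    have "cls a \<in> class_of_weight (weight a)"
      by (simp add: class_of_weight_def adm_of_weight_def)
    then have "Poly_Mapping.keys (frag_of (cls a)) \<subseteq> class_of_weight (weight a)"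
      by simp
    then show ?thesis using that unfolding is_delta_def by blast
  qed
  have eq: "d (frag_of (cls a)) = e (frag_of (cls a))" for a
  proof (induction "weight a" arbitrary: a rule: less_induct)
    case less
    show ?case
    proof (cases "a = \<emptyset>")
      case True
      then show ?thesis using assms by (simp add: is_delta_def)
    next
      case False
      have IH: "d (frag_of (cls (init a))) = e (frag_of (cls (init a)))"
        "d (frag_of (cls (mid a))) = e (frag_of (cls (mid a)))"
        "d (frag_of (cls (fin a))) = e (frag_of (cls (fin a)))"
        using less[OF weight_init_less[OF False]] less[OF weight_mid_less[OF False]]
          less[OF weight_fin_less[OF False]] .
      have rec: "init_lin (f (frag_of (cls a))) =
          f (frag_of (cls (init a))) + f (frag_of (cls (mid a))) + f (frag_of (cls (fin a)))"
        if "is_delta f" for f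
        using that False unfolding is_delta_def by blast
      have w: "weight a \<noteq> 0"
        using False by simp
      have "d (frag_of (cls a)) =
          frag_extend (\<lambda>c. frag_of (snoc (weight a) c)) (init_lin (d (frag_of (cls a))))"
        by (rule frag_extend_snoc_init_lin[OF keys[OF assms(1)] w, symmetric])
      also have "init_lin (d (frag_of (cls a))) = init_lin (e (frag_of (cls a)))"
        by (simp only: rec[OF assms(1)] rec[OF assms(2)] IH)
      also have "frag_extend (\<lambda>c. frag_of (snoc (weight a) c)) (init_lin (e (frag_of (cls a)))) =
          e (frag_of (cls a))"
        by (rule frag_extend_snoc_init_lin[OF keys[OF assms(2)] w])
      finally show ?thesis .
    qed
  qed
  have "d (frag_of b) = e (frag_of b)" for b
    using eq[of "rep_class b"] by (simp add: Quotient_abs_rep[OF Quotient_adm_class])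
  then have ext: "(\<lambda>b. d (frag_of b)) = (\<lambda>b. e (frag_of b))"
    by (rule ext)
  have "module_hom frag_cmul frag_cmul d" "module_hom frag_cmul frag_cmul e"
    using assms unfolding is_delta_def by blast+
  note hom = this[THEN module_hom_eq_frag_extend]
  show ?thesis
  proof
    fix x
    have "d x = frag_extend (\<lambda>b. e (frag_of b)) x"
      unfolding ext[symmetric] by (rule hom(1))
    also have "\<dots> = e x"
      by (rule hom(2)[symmetric])
    finally show "d x = e x" .
  qed
qed

lemma is_delta_ex: "is_delta (frag_extend (\<lambda>b. delta_rec (rep_class b)))"
proof -
  have rec_eq: "delta_rec (rep_class (cls a)) = delta_rec a" for a
  proof -
    have "dual_equiv a (rep_class (cls a))"
      using adm_class.abs_eq_iff Quotient_abs_rep[OF Quotient_adm_class] by metis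
    then show ?thesis by (auto simp: dual_equiv_def delta_rec_dual)
  qed
  have keys: "Poly_Mapping.keys (frag_extend (\<lambda>b. delta_rec (rep_class b)) x) \<subseteq> adm_of_weight k"
    if "Poly_Mapping.keys x \<subseteq> class_of_weight k" for k x
  proof -
    have "Poly_Mapping.keys (delta_rec (rep_class b)) \<subseteq> adm_of_weight k" if b: "b \<in> class_of_weight k" for b
    proof -
      obtain a where "b = cls a" "weight a = k"
        using b by (auto simp: class_of_weight_def adm_of_weight_def)
      then show ?thesis using keys_delta_rec[of a] by (simp add: rec_eq)
    qed
    then show ?thesis
      using that keys_frag_extend[of "\<lambda>b. delta_rec (rep_class b)" x] by blast
  qed
  have init: "init_lin (delta_rec a) = delta_rec (init a) + delta_rec (mid a) + delta_rec (fin a)"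
    if "a \<noteq> \<emptyset>" for a
  proof -
    let ?s = "delta_rec (init a) + delta_rec (mid a) + delta_rec (fin a)"
    have "weight c < weight a" if c: "c \<in> Poly_Mapping.keys ?s" for c
    proof -
      have "c \<in> Poly_Mapping.keys (delta_rec (init a)) \<union> Poly_Mapping.keys (delta_rec (mid a))
          \<union> Poly_Mapping.keys (delta_rec (fin a))"
        using c Poly_Mapping.keys_add[of "delta_rec (init a) + delta_rec (mid a)" "delta_rec (fin a)"]
          Poly_Mapping.keys_add[of "delta_rec (init a)" "delta_rec (mid a)"] by blast
      then show ?thesis
        using keys_delta_rec[of "init a"] keys_delta_rec[of "mid a"] keys_delta_rec[of "fin a"]
          weight_init_less[OF \<open>a \<noteq> \<emptyset>\<close>] weight_mid_less[OF \<open>a \<noteq> \<emptyset>\<close>] weight_fin_less[OF \<open>a \<noteq> \<emptyset>\<close>]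
        by (auto simp: adm_of_weight_def)
    qed
    then have "frag_extend (\<lambda>c. frag_of (init (snoc (weight a) c))) ?s = frag_extend frag_of ?s"
      using weight_ge_2[OF that] by (intro frag_extend_eq) (simp add: init_snoc)
    moreover have "init_lin (frag_extend (\<lambda>c. frag_of (snoc (weight a) c)) s) =
        frag_extend (\<lambda>c. frag_of (init (snoc (weight a) c))) s" for s
      unfolding init_lin_def frag_extend_def[of "\<lambda>c. frag_of (snoc (weight a) c)" s]
      by (simp add: frag_extend_sum frag_extend_cmul comp_def) (simp add: frag_extend_def)
    ultimately show ?thesis
      using that frag_expansion[of ?s, symmetric] by (simp add: delta_rec.simps[of a])
  qed
  show ?thesis
    unfolding is_delta_def
    using keys init by (simp add: module_hom_frag_extend rec_eq delta_rec.simps[of "\<emptyset>"])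
qed

lemma ex1_delta: "\<exists>!d. is_delta d"
  using is_delta_ex is_delta_unique by blast

definition delta :: "(adm_class \<Rightarrow>\<^sub>0 int) \<Rightarrow> (adm \<Rightarrow>\<^sub>0 int)" ("\<delta>") where
  "\<delta> = (THE d. is_delta d)"

lemma is_delta_delta: "is_delta \<delta>"
  unfolding delta_def using ex1_delta by (rule theI')

end

theory Submission
  imports Defs
begin

text \<open>
  Let \<open>S k\<close> be the signed sum over weight \<open>k\<close>. Appending an entry to a non-empty composition
  multiplies its coefficient by \<open>-1\<close> or \<open>-4\<close>, which expresses the sum of \<open>\<delta>[init a]\<close> through the
  \<open>S j\<close> with \<open>j < k\<close>. Duality preserves the height and exchanges the numbers of the two letters, so
  \<open>S k = 0\<close> for odd \<open>k\<close>, and it turns the formula for \<open>init\<close> into one for \<open>fin\<close>; composing the two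
  gives one for \<open>mid\<close>. Adding up, everything cancels for even \<open>k \<ge> 4\<close> except
  \<open>init (S k) = -9 S (k - 2)\<close>, and an element of fixed positive weight is determined by its image
  under \<open>init\<close>.
\<close>

section \<open>Height, depth and coefficients under duality\<close>

definition coef :: "adm \<Rightarrow> int" where
  "coef a = (-1) ^ depth a * 4 ^ (height a - 1)"

text \<open>Later \<open>f a\<close> is a coordinate of \<open>\<delta>\<close> at the class of
  \<open>a\<close>, so that identities in the free module become identities between
  integers.\<close>

definition coef_sum :: "(adm \<Rightarrow> int) \<Rightarrow> nat \<Rightarrow> int" where
  "coef_sum f k = (\<Sum>a\<in>adm_of_weight k. coef a * f a)"

text \<open>Counts the factors 01. Reversing and complementing maps 01 to itself, and the block of
  an entry \<open>x\<close> contains 01 iff \<open>2 \<le> x\<close>; this makes the height visibly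
  self-dual.\<close>

fun ascents :: "bool list \<Rightarrow> nat" where
  "ascents (x # y # w) = of_bool (\<not> x \<and> y) + ascents (y # w)"
| "ascents _ = 0"

lemma ascents_append: "ascents (w @ [x, y]) = ascents (w @ [x]) + of_bool (\<not> x \<and> y)"
  by (induction w rule: ascents.induct) auto

lemma ascents_dual_word: "ascents (dual_word w) = ascents w"
proof (induction w rule: ascents.induct)
  case (1 x y w)
  have "dual_word (x # y # w) = rev (map Not w) @ [\<not> y, \<not> x]"
    and "dual_word (y # w) = rev (map Not w) @ [\<not> y]"
    by (simp_all add: dual_word_def)
  with 1 show ?case by (auto simp: ascents_append)
qed (simp_all add: dual_word_def)

lemma ascents_True_Cons [simp]: "ascents (True # w) = ascents w"
  by (cases w) auto

lemma ascents_zeros_one: "ascents (replicate n False @ True # w) = of_bool (n \<noteq> 0) + ascents w"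
proof (induction n)
  case (Suc n)
  then show ?case by (cases n) auto
qed simp

lemma ascents_word: "ascents (word a) = length (filter (\<lambda>x. 2 \<le> x) a)"
  by (induction a) (auto simp: word_Cons ascents_zeros_one)

lemma height_dual: "height (dual a) = height a"
  by (simp add: height_def flip: ascents_word) (simp add: word_dual ascents_dual_word)

lemma length_filter_word: "length (filter id (word a)) = length a"
  by (induction a) (auto simp: word_Cons)

text \<open>The depth counts the letters 1 of the word; complementation makes the depth of the dual
  count its letters 0.\<close>

lemma depth_dual: "depth a + depth (dual a) = weight a"
proof -
  have "composition (list_of a)"
    using admissible_list_of[of a] by (simp add: admissible_def)
  then have "weight a = length (word (list_of a))"
    by (simp add: weight_def length_word)
  also have "\<dots> = length (filter id (word (list_of a))) + length (filter Not (word (list_of a)))"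
    using sum_length_filter_compl[of id "word (list_of a)"] by simp
  also have "length (filter Not (word (list_of a))) = length (filter id (dual_word (word (list_of a))))"
    by (simp add: dual_word_def rev_filter[symmetric] filter_map comp_def)
  finally show ?thesis
    unfolding word_dual[symmetric] length_filter_word by (simp add: depth_def)
qed

lemma coef_dual: "coef (dual a) = (-1) ^ weight a * coef a"
proof -
  have "(-1 :: int) ^ weight a * (-1) ^ depth a = (-1) ^ depth (dual a)"
    unfolding depth_dual[of a, symmetric] by (cases "even (depth a)") (simp_all add: power_add)
  then show ?thesis
    unfolding coef_def height_dual mult.assoc[symmetric] by simp
qed

text \<open>The truncated exponent \<open>height a - 1\<close> is 0 here, which is why the empty
  composition is exceptional below.\<close>

lemma coef_empty [simp]: "coef \<emptyset> = 1"
  by (simp add: coef_def depth_def height_def)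

section \<open>Weighted sums of init, fin and mid over a fixed weight\<close>

lemma height_pos: "a \<noteq> \<emptyset> \<Longrightarrow> 1 \<le> height a"
  using admissible_list_of[of a]
  by (cases "list_of a") (auto simp: admissible_def height_def)

text \<open>An appended 1 only flips the sign; a larger entry also raises the height, which costs a
  factor 4 unless it is the first entry.\<close>

lemma coef_snoc:
  assumes "weight b < k" "2 \<le> k"
  shows "coef (snoc k b) =
    (if b = \<emptyset> then -1 else if Suc (weight b) = k then - coef b else - 4 * coef b)"
proof (cases "b = \<emptyset>")
  case True
  then show ?thesis
    using assms by (simp add: coef_def depth_def height_def list_of_snoc)
next
  case False
  have "depth (snoc k b) = Suc (depth b)"
    using assms by (simp add: depth_def list_of_snoc)
  moreover have "height (snoc k b) = height b + of_bool (Suc (weight b) \<noteq> k)"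
    using assms by (auto simp: height_def list_of_snoc)
  moreover obtain h where "height b = Suc h"
    using height_pos[OF False] by (cases "height b") auto
  ultimately show ?thesis
    using False by (simp add: coef_def)
qed

lemma adm_of_weight_0: "adm_of_weight 0 = {\<emptyset>}"
  by (auto simp: adm_of_weight_def)

lemma coef_sum_0: "coef_sum f 0 = f \<emptyset>"
  by (simp add: coef_sum_def adm_of_weight_0)

lemma coef_sum_1: "coef_sum f (Suc 0) = 0"
proof -
  have "adm_of_weight (Suc 0) = {}"
    using weight_ge_2 unfolding adm_of_weight_def
    by (metis (lifting) Collect_empty_eq One_nat_def Suc_1 not_less_eq_eq order_refl weight_empty
        zero_neq_one)
  then show ?thesis by (simp add: coef_sum_def)
qed

lemma bij_betw_dual: "bij_betw dual (adm_of_weight k) (adm_of_weight k)"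
  by (rule bij_betw_byWitness[where f' = dual]) (auto simp: adm_of_weight_def)

lemma coef_sum_dual: "coef_sum (\<lambda>a. f (dual a)) k = (-1) ^ k * coef_sum f k"
proof -
  have "coef_sum f k = (\<Sum>a\<in>adm_of_weight k. coef (dual a) * f (dual a))"
    unfolding coef_sum_def by (rule sum.reindex_bij_betw[OF bij_betw_dual, symmetric])
  also have "\<dots> = (-1) ^ k * coef_sum (\<lambda>a. f (dual a)) k"
    unfolding coef_sum_def sum_distrib_left
    by (rule sum.cong) (auto simp: adm_of_weight_def coef_dual)
  finally show ?thesis
    by (cases "even k") simp_all
qed

text \<open>By \<open>snoc\<close>, \<open>init\<close> is a bijection from weight
  \<open>Suc k\<close> onto all weights at most \<open>k\<close>. Grouping by the weight
  \<open>j\<close> of \<open>init a\<close>, \<open>coef_snoc\<close> gives one factor for each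
  \<open>j\<close>.\<close>

lemma coef_sum_init:
  assumes "1 \<le> k"
  shows "coef_sum (\<lambda>a. f (init a)) (Suc k) =
    - f \<emptyset> - coef_sum f k - 4 * (\<Sum>j = 1..<k. coef_sum f j)"
proof -
  \<comment> \<open>The case \<open>j = 0\<close> is an empty \<open>init a\<close>, the case
    \<open>j = k\<close> a last entry 1.\<close>
  let ?m = "\<lambda>j. if j = 0 then -1 else if j = k then -1 else -4 :: int"
  have "coef_sum (\<lambda>a. f (init a)) (Suc k) =
      (\<Sum>b\<in>{b. weight b < Suc k}. coef (snoc (Suc k) b) * f b)"
    unfolding coef_sum_def
  proof (rule sum.reindex_bij_witness[where i = "snoc (Suc k)" and j = init])
    fix a assume "a \<in> adm_of_weight (Suc k)"
    then have a: "weight a = Suc k" "a \<noteq> \<emptyset>"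
      by (auto simp: adm_of_weight_def)
    then show "snoc (Suc k) (init a) = a" "init a \<in> {b. weight b < Suc k}"
      using snoc_init[of a] weight_init_less[of a] by simp_all
    then show "coef (snoc (Suc k) (init a)) * f (init a) = coef a * f (init a)"
      by simp
  qed (use assms in \<open>auto simp: init_snoc weight_snoc adm_of_weight_def\<close>)
  also have "{b. weight b < Suc k} = (\<Union>j\<in>{..k}. adm_of_weight j)"
    by (auto simp: adm_of_weight_def)
  also have "(\<Sum>b\<in>(\<Union>j\<in>{..k}. adm_of_weight j). coef (snoc (Suc k) b) * f b) =
      (\<Sum>j\<le>k. \<Sum>b\<in>adm_of_weight j. coef (snoc (Suc k) b) * f b)"
    by (rule sum.UNION_disjoint) (auto simp: finite_adm_of_weight, auto simp: adm_of_weight_def)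
  also have "\<dots> = (\<Sum>j\<le>k. ?m j * coef_sum f j)"
    unfolding coef_sum_def sum_distrib_left
    by (intro sum.cong) (use assms in \<open>auto simp: adm_of_weight_def coef_snoc\<close>)
  also have "{..k} = insert 0 (insert k {1..<k})"
    using assms by auto
  also have "(\<Sum>j\<in>insert 0 (insert k {1..<k}). ?m j * coef_sum f j) =
      - f \<emptyset> - coef_sum f k + (\<Sum>j = 1..<k. ?m j * coef_sum f j)"
    using assms by (simp add: coef_sum_0)
  also have "(\<Sum>j = 1..<k. ?m j * coef_sum f j) = - 4 * (\<Sum>j = 1..<k. coef_sum f j)"
    unfolding sum_distrib_left by (rule sum.cong) auto
  finally show ?thesis by simp
qed

text \<open>\<open>fin\<close> is \<open>init\<close> conjugated by \<open>dual\<close>: the inner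
  \<open>dual\<close> gives the sign of weight \<open>Suc k\<close>, the outer one a sign for each
  weight \<open>j\<close>.\<close>

lemma coef_sum_fin:
  assumes "1 \<le> k"
  shows "coef_sum (\<lambda>a. f (fin a)) (Suc k) =
    (-1) ^ k * f \<emptyset> + coef_sum f k + 4 * (-1) ^ k * (\<Sum>j = 1..<k. (-1) ^ j * coef_sum f j)"
proof -
  have "coef_sum (\<lambda>a. f (fin a)) (Suc k) =
      (-1) ^ Suc k * coef_sum (\<lambda>a. f (dual (init a))) (Suc k)"
    unfolding fin_def using coef_sum_dual[of "\<lambda>a. f (dual (init a))" "Suc k"] by simp
  also have "\<dots> = (-1) ^ Suc k *
      (- f \<emptyset> - (-1) ^ k * coef_sum f k - 4 * (\<Sum>j = 1..<k. (-1) ^ j * coef_sum f j))"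
    using coef_sum_init[OF assms, of "\<lambda>a. f (dual a)"] by (simp add: coef_sum_dual)
  finally show ?thesis
    by (cases "even k") simp_all
qed

text \<open>By \<open>coef_sum_dual\<close> such a sum equals its own negative.\<close>

lemma coef_sum_odd:
  assumes "\<And>a. f (dual a) = f a" "odd k"
  shows "coef_sum f k = 0"
  using coef_sum_dual[of f k] assms by simp

text \<open>In the notation of the proof, \<open>init\<close> and \<open>fin\<close> each contribute
  \<open>- e - 4 * s n - 4 * t (2 * n)\<close> and \<open>mid\<close> contributes
  \<open>2 * e + 8 * s n - t (2 * n)\<close>, so \<open>e\<close> and \<open>s n\<close>
  cancel.\<close>

lemma coef_sum_init_mid_fin:
  assumes f: "\<And>a. f (dual a) = f a" and "1 \<le> n"
  shows "coef_sum (\<lambda>a. f (init a) + f (mid a) + f (fin a)) (2 * n + 2) = - 9 * coef_sum f (2 * n)"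
proof -
  define t where "t = coef_sum f"
  define p where "p = coef_sum (\<lambda>a. f (init a))"
  define s where "s = (\<lambda>n. \<Sum>j = 1..<2 * n. t j)"
  define e where "e = f \<emptyset>"
  have odd: "t k = 0" if "odd k" for k
    using coef_sum_odd[of f k] f that by (simp add: t_def)
  have s_Suc: "s (Suc m) = s m + t (2 * m)" if "1 \<le> m" for m
    using that odd[of "2 * m + 1"] by (simp add: s_def)
  have p_odd: "p (2 * m + 1) = - e - t (2 * m) - 4 * s m" if "1 \<le> m" for m
    using that coef_sum_init[of "2 * m" f] by (simp add: p_def t_def s_def e_def)
  have p_even: "p (2 * m + 2) = - e - 4 * s (Suc m)" for m
    using coef_sum_init[of "2 * m + 1" f] odd[of "2 * m + 1"]
    by (simp add: p_def t_def s_def e_def)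
  \<comment> \<open>Needed for \<open>mid\<close>. The sum telescopes, since
    \<open>p (2 * m + 2) - p (2 * m + 1) = - 3 * t (2 * m)\<close>; it starts from
    \<open>p 2 = - e\<close>, as weight 1 is empty.\<close>
  have alt: "(\<Sum>j = 1..<2 * m + 1. (-1) ^ j * p j) = - e - 3 * s m" if "1 \<le> m" for m
    using that
  proof (induction m rule: dec_induct)
    case base
    have "p (Suc 0) = 0" "s (Suc 0) = 0"
      using odd[of 1] by (simp_all add: p_def coef_sum_1 s_def numeral_2_eq_2)
    then show ?case
      using p_even[of 0] by (simp add: numeral_2_eq_2)
  next
    case (step m)
    have "(\<Sum>j = 1..<2 * Suc m + 1. (-1) ^ j * p j) =
        (\<Sum>j = 1..<2 * m + 1. (-1) ^ j * p j) - p (2 * m + 1) + p (2 * m + 2)"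
      by simp
    then show ?case
      using step p_odd[of m] p_even[of m] s_Suc[of m] by simp
  qed
  have init: "coef_sum (\<lambda>a. f (init a)) (2 * n + 2) = - e - 4 * s n - 4 * t (2 * n)"
    using p_even[of n] s_Suc[OF \<open>1 \<le> n\<close>] by (simp add: p_def)
  \<comment> \<open>Invariance of \<open>f\<close> removes the outer \<open>dual\<close>; in even
    weight the inner one costs no sign.\<close>
  have "coef_sum (\<lambda>a. f (fin a)) (2 * n + 2) = coef_sum (\<lambda>a. f (dual (init (dual a)))) (2 * n + 2)"
    by (simp add: fin_def)
  also have "\<dots> = coef_sum (\<lambda>a. f (init a)) (2 * n + 2)"
    using coef_sum_dual[of "\<lambda>a. f (init a)" "2 * n + 2"] by (simp add: f)
  finally have fin: "coef_sum (\<lambda>a. f (fin a)) (2 * n + 2) = - e - 4 * s n - 4 * t (2 * n)"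
    using init by simp
  \<comment> \<open>\<open>coef_sum_fin\<close> is applied to \<open>f\<close> after
    \<open>init\<close>, so its alternating sum is that of \<open>p\<close>.\<close>
  have "coef_sum (\<lambda>a. f (mid a)) (2 * n + 2) =
      - e + p (2 * n + 1) - 4 * (\<Sum>j = 1..<2 * n + 1. (-1) ^ j * p j)"
    using coef_sum_fin[of "2 * n + 1" "\<lambda>a. f (init a)"] by (simp add: mid_def p_def e_def)
  then have mid: "coef_sum (\<lambda>a. f (mid a)) (2 * n + 2) = 2 * e - t (2 * n) + 8 * s n"
    using alt[OF \<open>1 \<le> n\<close>] p_odd[OF \<open>1 \<le> n\<close>] by simp
  have "coef_sum (\<lambda>a. f (init a) + f (mid a) + f (fin a)) (2 * n + 2) =
      coef_sum (\<lambda>a. f (init a)) (2 * n + 2) + coef_sum (\<lambda>a. f (mid a)) (2 * n + 2) +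
      coef_sum (\<lambda>a. f (fin a)) (2 * n + 2)"
    by (simp add: coef_sum_def distrib_left sum.distrib)
  then show ?thesis
    unfolding init mid fin by (simp add: t_def)
qed

section \<open>Transfer to \<open>\<delta>\<close>\<close>

definition class_sum :: "nat \<Rightarrow> adm_class \<Rightarrow>\<^sub>0 int" where
  "class_sum k = (\<Sum>a\<in>adm_of_weight k. frag_cmul (coef a) (frag_of (cls a)))"

lemma delta_class_sum:
  "\<delta> (class_sum k) = (\<Sum>a\<in>adm_of_weight k. frag_cmul (coef a) (\<delta> (frag_of (cls a))))"
proof -
  interpret module_hom frag_cmul frag_cmul \<delta>
    using is_delta_delta by (simp add: is_delta_def)
  show ?thesis by (simp add: class_sum_def sum scale)
qed

lemma lookup_coef_sum:
  "Poly_Mapping.lookup (\<Sum>a\<in>adm_of_weight k. frag_cmul (coef a) (F a)) c =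
    coef_sum (\<lambda>a. Poly_Mapping.lookup (F a) c) k"
  by (simp add: coef_sum_def lookup_sum)

lemma init_lin_delta_class_sum:
  assumes "1 \<le> k"
  shows "init_lin (\<delta> (class_sum k)) = (\<Sum>a\<in>adm_of_weight k. frag_cmul (coef a)
    (\<delta> (frag_of (cls (init a))) + \<delta> (frag_of (cls (mid a))) + \<delta> (frag_of (cls (fin a)))))"
proof -
  have "init_lin (\<delta> (class_sum k)) =
      (\<Sum>a\<in>adm_of_weight k. frag_cmul (coef a) (init_lin (\<delta> (frag_of (cls a)))))"
    unfolding delta_class_sum init_lin_def
    by (simp add: frag_extend_sum finite_adm_of_weight frag_extend_cmul comp_def)
  also have "\<dots> = (\<Sum>a\<in>adm_of_weight k. frag_cmul (coef a)
    (\<delta> (frag_of (cls (init a))) + \<delta> (frag_of (cls (mid a))) + \<delta> (frag_of (cls (fin a)))))"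
  proof (rule sum.cong)
    fix a assume "a \<in> adm_of_weight k"
    then have "a \<noteq> \<emptyset>" using assms by (auto simp: adm_of_weight_def)
    then show "frag_cmul (coef a) (init_lin (\<delta> (frag_of (cls a)))) = frag_cmul (coef a)
        (\<delta> (frag_of (cls (init a))) + \<delta> (frag_of (cls (mid a))) + \<delta> (frag_of (cls (fin a))))"
      using is_delta_delta by (simp add: is_delta_def)
  qed simp
  finally show ?thesis .
qed

text \<open>In fixed weight the entry deleted by \<open>init\<close> is the missing weight, so
  \<open>snoc k\<close> restores it.\<close>

lemma delta_class_sum_conv_init:
  assumes "k \<noteq> 0"
  shows "\<delta> (class_sum k) = frag_extend (\<lambda>c. frag_of (snoc k c)) (init_lin (\<delta> (class_sum k)))"
proof -
  have "Poly_Mapping.keys (class_sum k) \<subseteq> class_of_weight k"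
  proof -
    have "Poly_Mapping.keys (class_sum k) \<subseteq>
        (\<Union>a\<in>adm_of_weight k. Poly_Mapping.keys (frag_cmul (coef a) (frag_of (cls a))))"
      unfolding class_sum_def by (rule keys_sum)
    also have "\<dots> \<subseteq> class_of_weight k"
      using keys_cmul by (fastforce simp: class_of_weight_def)
    finally show ?thesis .
  qed
  then have "Poly_Mapping.keys (\<delta> (class_sum k)) \<subseteq> adm_of_weight k"
    using is_delta_delta by (simp add: is_delta_def)
  then show ?thesis
    using frag_extend_snoc_init_lin assms by simp
qed

lemma init_lin_delta_class_sum_even:
  assumes "1 \<le> n"
  shows "init_lin (\<delta> (class_sum (2 * n + 2))) = frag_cmul (- 9) (\<delta> (class_sum (2 * n)))"
proof (rule poly_mapping_eqI)
  fix c
  have k: "1 \<le> 2 * n + 2" by simp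
  show "Poly_Mapping.lookup (init_lin (\<delta> (class_sum (2 * n + 2)))) c =
      Poly_Mapping.lookup (frag_cmul (- 9) (\<delta> (class_sum (2 * n)))) c"
    \<comment> \<open>This coordinate depends on \<open>a\<close> only through \<open>cls a\<close>,
      hence is invariant under \<open>dual\<close>.\<close>
    using coef_sum_init_mid_fin[of "\<lambda>a. Poly_Mapping.lookup (\<delta> (frag_of (cls a))) c" n] assms
    unfolding init_lin_delta_class_sum[OF k] unfolding delta_class_sum
    by (simp add: lookup_coef_sum lookup_add)
qed

section \<open>The compositions (2,...,2) and the induction on \<open>r\<close>\<close>

lemma admissible_replicate_2: "admissible (replicate r 2)"
  by (cases r) (auto simp: admissible_def composition_def)

lemma weight_replicate_2: "weight (Adm (replicate r 2)) = 2 * r"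
  by (simp add: weight_def list_of_Adm admissible_replicate_2 sum_list_replicate)

lemma snoc_replicate_2: "snoc (2 * r + 2) (Adm (replicate r 2)) = Adm (replicate (Suc r) 2)"
  by (simp add: snoc_def weight_replicate_2 list_of_Adm admissible_replicate_2 replicate_append_same)

lemma adm_of_weight_2: "adm_of_weight 2 = {Adm [2]}"
proof -
  have "a = Adm [2]" if "weight a = 2" for a
  proof -
    have ne: "a \<noteq> \<emptyset>" using that by auto
    then have "weight (init a) < 2"
      using weight_init_less[of a] that by simp
    then have "init a = \<emptyset>"
      using weight_ge_2[of "init a"] by fastforce
    then show ?thesis
      using snoc_init[OF ne] that by (simp add: snoc_def)
  qed
  moreover have "weight (Adm [2]) = 2"
    using weight_replicate_2[of 1] by simp
  ultimately show ?thesis unfolding adm_of_weight_def by blast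
qed

text \<open>In weight 2 all three terms of the recursion are the empty composition, whence -3
  instead of the later -9.\<close>

lemma init_lin_delta_class_sum_2: "init_lin (\<delta> (class_sum 2)) = frag_cmul (- 3) (frag_of \<emptyset>)"
proof -
  have l: "list_of (Adm [2]) = [2]"
    using admissible_replicate_2[of 1] by (simp add: list_of_Adm)
  then have "list_of (init (Adm [2])) = []" "list_of (fin (Adm [2])) = []"
    by (simp_all add: list_of_init list_of_fin fin_list_def)
  then have if2: "init (Adm [2]) = \<emptyset>" "fin (Adm [2]) = \<emptyset>"
    by simp_all
  have "coef (Adm [2]) = - 1"
    by (simp add: coef_def depth_def height_def l)
  moreover have "\<delta> (frag_of (cls \<emptyset>)) = frag_of \<emptyset>"
    using is_delta_delta by (simp add: is_delta_def)
  ultimately have "init_lin (\<delta> (class_sum 2)) =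
      frag_cmul (- 1) (frag_of \<emptyset> + frag_of \<emptyset> + frag_of \<emptyset>)"
    by (simp add: init_lin_delta_class_sum adm_of_weight_2 if2 mid_def)
  also have "\<dots> = frag_cmul (- 3) (frag_of \<emptyset>)"
    by (rule poly_mapping_eqI) (simp add: lookup_add lookup_minus)
  finally show ?thesis .
qed

text \<open>Each step multiplies by -9, and \<open>snoc\<close> appends the missing weight
  \<open>(2 * r + 2) - 2 * r = 2\<close>.\<close>

lemma delta_class_sum_even:
  assumes "1 \<le> r"
  shows "\<delta> (class_sum (2 * r)) =
    frag_cmul ((-1) ^ r * 3 ^ (2 * r - 1)) (frag_of (Adm (replicate r 2)))"
  using assms
proof (induction r rule: dec_induct)
  case base
  have "\<delta> (class_sum 2) = frag_cmul (- 3) (frag_of (snoc 2 \<emptyset>))"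
    using delta_class_sum_conv_init[of 2]
    unfolding init_lin_delta_class_sum_2 by (simp add: frag_extend_cmul)
  then show ?case
    by (simp add: snoc_def)
next
  case (step r)
  \<comment> \<open>Makes \<open>2 * r - 1\<close> a genuine difference, so that the factor 9 raises
    the exponent of 3 by two.\<close>
  obtain m where r: "r = Suc m"
    using step by (cases r) auto
  have "\<delta> (class_sum (2 * r + 2)) =
      frag_cmul (- 9 * ((-1) ^ r * 3 ^ (2 * r - 1))) (frag_of (snoc (2 * r + 2) (Adm (replicate r 2))))"
    using delta_class_sum_conv_init[of "2 * r + 2"]
    unfolding init_lin_delta_class_sum_even[OF step.hyps(1)] step.IH
    by (simp add: frag_extend_cmul)
  moreover have "- 9 * ((-1) ^ r * 3 ^ (2 * r - 1)) = (-1 :: int) ^ Suc r * 3 ^ (2 * Suc r - 1)"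
    by (simp add: r)
  ultimately show ?case
    unfolding snoc_replicate_2 by (simp only: mult_Suc_right add.commute)
qed

theorem theorem22:
  fixes r :: nat
  assumes "r \<ge> 1"
  shows "\<delta> (\<Sum>a\<in>adm_of_weight (2 * r).
             frag_cmul ((-1) ^ depth a * 4 ^ (height a - 1)) (frag_of (cls a)))
         = frag_cmul ((-1) ^ r * 3 ^ (2 * r - 1)) (frag_of (Adm (replicate r 2)))"
  using delta_class_sum_even[OF assms] unfolding class_sum_def coef_def .

end
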